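(* Let $T$ be a $\lambda C$-term such that $\vdash_{M2} T:\forall X_C\{\perp\rightarrow X_C\}$, where $X_C$ is a classical variable of arity $0$. Then for every integer $n$ and all $\lambda C$-terms $t,t_1,\dots,t_n$, we have $(T)t\,t_1\dots t_n\succ_C t$.
   Context: $\lambda C$-terms are terms of the pure $\lambda$-calculus extended with a constant $C$; $(t)u_1\dots u_n$ denotes iterated application. $\succ_C$ is the reflexive–transitive closure of $(\lambda xu)t\,t_1\dots t_n\to(u[t/x])t_1\dots t_n$ and $(C)t\,t_1\dots t_n\to(t)\lambda x(x)t_1\dots t_n$ ($x$ fresh). System $M2$: types are second-order formulas built from $\perp$ and atomic formulas using $\rightarrow,\forall x,\forall X$ (first-order terms, equations $u=v:=\forall Y(Y(u)\rightarrow Y(v))$, a fixed set of equations with $a\approx b$ meaning $a=b$ follows from it); $\neg A=A\rightarrow\perp$. Besides ordinary predicate variables there are classical predicate variables $X_C$. A type ends with $X$ if it is $X(\vec t)$, or $A\rightarrow B$ with $B$ ending with $X$, or $\forall vA$ with $A$ ending with $X$; a classical type ends with $\perp$ or a classical variable. Rules: axiom; $\rightarrow$-intro/elim; $\forall x$-intro ($x$ not free in context)/elim (any term); $\forall X$-intro/elim (any formula) for ordinary $X$; equational rule (from $t:A[u/x]$ and $u\approx v$ get $t:A[v/x]$); $\Gamma\vdash C:\forall X_C\{\neg\neg X_C\rightarrow X_C\}$; $\forall X_C$-intro ($X_C$ not free in context); $\forall X_C$-elim instantiating only by classical types. *)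

theory Defs
  imports Main
begin

section \<open>Terms of the lambda-calculus with the constant C\<close>

text \<open>De Bruijn indices are used for all variables, so that objects are identified up to renaming
  of bound variables.  All substitutions are simultaneous.\<close>

datatype lam = Var nat | App lam lam | Lam lam | Cst

primrec lren :: "(nat \<Rightarrow> nat) \<Rightarrow> lam \<Rightarrow> lam" where
  "lren r (Var i) = Var (r i)"
| "lren r (App t u) = App (lren r t) (lren r u)"
| "lren r (Lam t) = Lam (lren (case_nat 0 (\<lambda>i. Suc (r i))) t)"
| "lren r Cst = Cst"

primrec lsubst :: "(nat \<Rightarrow> lam) \<Rightarrow> lam \<Rightarrow> lam" where
  "lsubst s (Var i) = s i"
| "lsubst s (App t u) = App (lsubst s t) (lsubst s u)"
| "lsubst s (Lam t) = Lam (lsubst (case_nat (Var 0) (\<lambda>i. lren Suc (s i))) t)"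
| "lsubst s Cst = Cst"

definition apps :: "lam \<Rightarrow> lam list \<Rightarrow> lam" where
  "apps t ts = foldl App t ts"

text \<open>In the second rule the arguments are moved under a new abstraction and hence renamed
  by \<open>Suc\<close>; this is the freshness condition on the bound variable.\<close>

inductive stepC :: "lam \<Rightarrow> lam \<Rightarrow> bool" where
  beta: "stepC (apps (App (Lam u) t) ts) (apps (lsubst (case_nat t Var) u) ts)"
| ctrl: "stepC (apps (App Cst t) ts) (App t (Lam (apps (Var 0) (map (lren Suc) ts))))"

definition redC :: "lam \<Rightarrow> lam \<Rightarrow> bool"  (infix \<open>\<succ>\<^sub>C\<close> 50) where
  "t \<succ>\<^sub>C u \<longleftrightarrow> stepC\<^sup>*\<^sup>* t u"


section \<open>First-order terms and equations\<close>

text \<open>A language is given by its function symbols and predicate symbols together with their arities.\<close>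

record ('f, 'p) lang =
  funs :: "('f \<times> nat) set"
  preds :: "('p \<times> nat) set"

datatype 'f tm = V nat | Fn 'f "'f tm list"

fun wf_tm :: "('f, 'p) lang \<Rightarrow> 'f tm \<Rightarrow> bool" where
  "wf_tm L (V i) \<longleftrightarrow> True"
| "wf_tm L (Fn f us) \<longleftrightarrow> (f, length us) \<in> funs L \<and> (\<forall>u \<in> set us. wf_tm L u)"

primrec tsubst :: "(nat \<Rightarrow> 'f tm) \<Rightarrow> 'f tm \<Rightarrow> 'f tm" where
  "tsubst s (V i) = s i"
| "tsubst s (Fn f us) = Fn f (map (tsubst s) us)"

text \<open>\<open>eq_conseq L E a b\<close>: the equation \<open>a = b\<close> follows from the set \<open>E\<close> of equations by equational
  logic; the variables of the equations in \<open>E\<close> are implicitly universally quantified.\<close>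

inductive eq_conseq :: "('f, 'p) lang \<Rightarrow> ('f tm \<times> 'f tm) set \<Rightarrow> 'f tm \<Rightarrow> 'f tm \<Rightarrow> bool"
  for L E where
  inst: "(a, b) \<in> E \<Longrightarrow> \<forall>i. wf_tm L (s i) \<Longrightarrow> eq_conseq L E (tsubst s a) (tsubst s b)"
| refl: "wf_tm L a \<Longrightarrow> eq_conseq L E a a"
| sym: "eq_conseq L E a b \<Longrightarrow> eq_conseq L E b a"
| trans: "eq_conseq L E a b \<Longrightarrow> eq_conseq L E b c \<Longrightarrow> eq_conseq L E a c"
| cong: "(f, length us) \<in> funs L \<Longrightarrow> list_all2 (eq_conseq L E) us vs \<Longrightarrow>
    eq_conseq L E (Fn f us) (Fn f vs)"


section \<open>Types\<close>

datatype kind = Ordinary | Classical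

text \<open>There is a separate family of de Bruijn indices for first-order variables and, for each kind
  and each arity \<open>n\<close>, for the predicate variables of this kind and arity.  \<open>PVar k i us\<close> is the
  \<open>i\<close>-th predicate variable of kind \<open>k\<close> and arity \<open>length us\<close>, applied to \<open>us\<close>; \<open>All2 k n\<close> binds
  index 0 of the family of kind \<open>k\<close> and arity \<open>n\<close> and leaves the other families alone.\<close>

datatype ('f, 'p) form =
    Bot
  | PSym 'p "'f tm list"
  | PVar kind nat "'f tm list"
  | Imp "('f, 'p) form" "('f, 'p) form"
  | All1 "('f, 'p) form"
  | All2 kind nat "('f, 'p) form"

abbreviation Neg :: "('f, 'p) form \<Rightarrow> ('f, 'p) form" where
  "Neg A \<equiv> Imp A Bot"

primrec wf_form :: "('f, 'p) lang \<Rightarrow> ('f, 'p) form \<Rightarrow> bool" where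
  "wf_form L Bot \<longleftrightarrow> True"
| "wf_form L (PSym p us) \<longleftrightarrow> (p, length us) \<in> preds L \<and> (\<forall>u \<in> set us. wf_tm L u)"
| "wf_form L (PVar k i us) \<longleftrightarrow> (\<forall>u \<in> set us. wf_tm L u)"
| "wf_form L (Imp A B) \<longleftrightarrow> wf_form L A \<and> wf_form L B"
| "wf_form L (All1 A) \<longleftrightarrow> wf_form L A"
| "wf_form L (All2 k n A) \<longleftrightarrow> wf_form L A"

text \<open>The formula with which a type ends, read under the quantifiers passed on the way.\<close>

primrec ending :: "('f, 'p) form \<Rightarrow> ('f, 'p) form" where
  "ending Bot = Bot"
| "ending (PSym p us) = PSym p us"
| "ending (PVar k i us) = PVar k i us"
| "ending (Imp A B) = ending B"
| "ending (All1 A) = ending A"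
| "ending (All2 k n A) = ending A"

definition classical_type :: "('f, 'p) form \<Rightarrow> bool" where
  "classical_type A \<longleftrightarrow> ending A = Bot \<or> (\<exists>i us. ending A = PVar Classical i us)"


section \<open>Substitution in types\<close>

primrec fsubst :: "(nat \<Rightarrow> 'f tm) \<Rightarrow> ('f, 'p) form \<Rightarrow> ('f, 'p) form" where
  "fsubst s Bot = Bot"
| "fsubst s (PSym p us) = PSym p (map (tsubst s) us)"
| "fsubst s (PVar k i us) = PVar k i (map (tsubst s) us)"
| "fsubst s (Imp A B) = Imp (fsubst s A) (fsubst s B)"
| "fsubst s (All1 A) = All1 (fsubst (case_nat (V 0) (\<lambda>i. tsubst (\<lambda>j. V (Suc j)) (s i))) A)"
| "fsubst s (All2 k n A) = All2 k n (fsubst s A)"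

definition fshift :: "('f, 'p) form \<Rightarrow> ('f, 'p) form" where
  "fshift A = fsubst (\<lambda>i. V (Suc i)) A"

text \<open>\<open>finst u A\<close> is \<open>A[u/x]\<close>, where \<open>x\<close> is the variable with index 0 in \<open>A\<close>.\<close>

definition finst :: "'f tm \<Rightarrow> ('f, 'p) form \<Rightarrow> ('f, 'p) form" where
  "finst u A = fsubst (case_nat u V) A"

text \<open>Renamings and substitutions of predicate variables take the kind, the arity and the index of
  a variable, in this order.\<close>

primrec pren :: "(kind \<Rightarrow> nat \<Rightarrow> nat \<Rightarrow> nat) \<Rightarrow> ('f, 'p) form \<Rightarrow> ('f, 'p) form" where
  "pren r Bot = Bot"
| "pren r (PSym p us) = PSym p us"
| "pren r (PVar k i us) = PVar k (r k (length us) i) us"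
| "pren r (Imp A B) = Imp (pren r A) (pren r B)"
| "pren r (All1 A) = All1 (pren r A)"
| "pren r (All2 k n A) = All2 k n
    (pren (\<lambda>k' n'. if k' = k \<and> n' = n then case_nat 0 (\<lambda>i. Suc (r k n i)) else r k' n') A)"

definition pshift :: "kind \<Rightarrow> nat \<Rightarrow> ('f, 'p) form \<Rightarrow> ('f, 'p) form" where
  "pshift k n A = pren (\<lambda>k' n' i. if k' = k \<and> n' = n then Suc i else i) A"

text \<open>An \<open>n\<close>-ary predicate variable is replaced by a formula with \<open>n\<close> parameters
  \<open>x\<^sub>1, \<dots>, x\<^sub>n\<close>.  These are the first-order indices \<open>0, \<dots>, n - 1\<close> of the formula; its index
  \<open>n + j\<close> stands for the variable \<open>j\<close> of the surrounding context.  \<open>params us\<close> substitutes \<open>us\<close> for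
  the parameters.\<close>

definition params :: "'f tm list \<Rightarrow> nat \<Rightarrow> 'f tm" where
  "params us j = (if j < length us then us ! j else V (j - length us))"

definition pvar :: "kind \<Rightarrow> nat \<Rightarrow> nat \<Rightarrow> ('f, 'p) form" where
  "pvar k n i = PVar k i (map V [0..<n])"

primrec psubst :: "(kind \<Rightarrow> nat \<Rightarrow> nat \<Rightarrow> ('f, 'p) form) \<Rightarrow> ('f, 'p) form \<Rightarrow> ('f, 'p) form" where
  "psubst s Bot = Bot"
| "psubst s (PSym p us) = PSym p us"
| "psubst s (PVar k i us) = fsubst (params us) (s k (length us) i)"
| "psubst s (Imp A B) = Imp (psubst s A) (psubst s B)"
| "psubst s (All1 A) = All1
    (psubst (\<lambda>k n i. fsubst (\<lambda>j. if j < n then V j else V (Suc j)) (s k n i)) A)"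
| "psubst s (All2 k n A) = All2 k n
    (psubst (\<lambda>k' n'.
        if k' = k \<and> n' = n then case_nat (pvar k n 0) (\<lambda>i. pshift k n (s k n i))
        else (\<lambda>i. pshift k n (s k' n' i))) A)"

text \<open>\<open>pinst k n G A\<close> is \<open>A[G/X]\<close>, where \<open>X\<close> is the variable with index 0 of kind \<open>k\<close> and arity
  \<open>n\<close> in \<open>A\<close>, and \<open>G\<close> has \<open>n\<close> parameters as above.\<close>

definition pinst :: "kind \<Rightarrow> nat \<Rightarrow> ('f, 'p) form \<Rightarrow> ('f, 'p) form \<Rightarrow> ('f, 'p) form" where
  "pinst k n G A = psubst (\<lambda>k' n'.
     if k' = k \<and> n' = n then case_nat G (\<lambda>i. pvar k n i) else pvar k' n') A"


section \<open>The type system M2\<close>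

text \<open>\<open>M2 L E \<Gamma> t A\<close>: over the language \<open>L\<close> and the equations \<open>E\<close>, the term \<open>t\<close> has type \<open>A\<close> in the
  context \<open>\<Gamma>\<close>, whose \<open>i\<close>-th entry is the type of the variable \<open>i\<close>.  The eigenvariable conditions of
  the quantifier introductions are expressed by shifting the context.\<close>

inductive M2 :: "('f, 'p) lang \<Rightarrow> ('f tm \<times> 'f tm) set \<Rightarrow> ('f, 'p) form list \<Rightarrow> lam \<Rightarrow>
    ('f, 'p) form \<Rightarrow> bool"
  for L E where
  ax: "\<forall>B \<in> set \<Gamma>. wf_form L B \<Longrightarrow> i < length \<Gamma> \<Longrightarrow> M2 L E \<Gamma> (Var i) (\<Gamma> ! i)"
| impI: "M2 L E (A # \<Gamma>) t B \<Longrightarrow> M2 L E \<Gamma> (Lam t) (Imp A B)"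
| impE: "M2 L E \<Gamma> t (Imp A B) \<Longrightarrow> M2 L E \<Gamma> u A \<Longrightarrow> M2 L E \<Gamma> (App t u) B"
| all1I: "M2 L E (map fshift \<Gamma>) t A \<Longrightarrow> M2 L E \<Gamma> t (All1 A)"
| all1E: "M2 L E \<Gamma> t (All1 A) \<Longrightarrow> wf_tm L u \<Longrightarrow> M2 L E \<Gamma> t (finst u A)"
| all2I: "M2 L E (map (pshift Ordinary n) \<Gamma>) t A \<Longrightarrow> M2 L E \<Gamma> t (All2 Ordinary n A)"
| all2E: "M2 L E \<Gamma> t (All2 Ordinary n A) \<Longrightarrow> wf_form L G \<Longrightarrow>
    M2 L E \<Gamma> t (pinst Ordinary n G A)"
| eqn: "M2 L E \<Gamma> t (finst u A) \<Longrightarrow> eq_conseq L E u v \<Longrightarrow> M2 L E \<Gamma> t (finst v A)"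
| cst: "\<forall>B \<in> set \<Gamma>. wf_form L B \<Longrightarrow>
    M2 L E \<Gamma> Cst (All2 Classical 0 (Imp (Neg (Neg (PVar Classical 0 []))) (PVar Classical 0 [])))"
| allCI: "M2 L E (map (pshift Classical n) \<Gamma>) t A \<Longrightarrow> M2 L E \<Gamma> t (All2 Classical n A)"
| allCE: "M2 L E \<Gamma> t (All2 Classical n A) \<Longrightarrow> wf_form L G \<Longrightarrow> classical_type G \<Longrightarrow>
    M2 L E \<Gamma> t (pinst Classical n G A)"

end

(* Realizability: fix a set P of terms closed under stepC-expansion and interpret Bot by P, classical
   variables by orthogonals (with respect to P) of sets of stacks, and ordinary variables by arbitrary
   sets closed under head beta-expansion.  Classical types then denote orthogonals, which is
   what the instantiation of classical variables and the typing of Cst require.  First-order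
   objects carry no computational content, so the first-order domain may be a single point, and the
   equational rule becomes trivial.  The theorem is the adequacy lemma for P the set of all terms
   reducing to t, the classical variable being interpreted by the orthogonal of the stack ts. *)

theory Submission imports Defs begin

section \<open>Substitution in terms\<close>

lemma lren_lren: "lren r (lren q t) = lren (\<lambda>i. r (q i)) t"
proof (induction t arbitrary: r q)
  case (Lam t)
  have "(\<lambda>i. case_nat 0 (\<lambda>i. Suc (r i)) (case_nat 0 (\<lambda>i. Suc (q i)) i))
      = case_nat 0 (\<lambda>i. Suc (r (q i)))"
    by (auto split: nat.split)
  then show ?case by (simp add: Lam)
qed auto

lemma lsubst_lren: "lsubst s (lren r t) = lsubst (\<lambda>i. s (r i)) t"
proof (induction t arbitrary: s r)
  case (Lam t)
  have "(\<lambda>i. case_nat (Var 0) (\<lambda>i. lren Suc (s i)) (case_nat 0 (\<lambda>i. Suc (r i)) i))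
      = case_nat (Var 0) (\<lambda>i. lren Suc (s (r i)))"
    by (auto split: nat.split)
  then show ?case by (simp add: Lam)
qed auto

lemma lren_lsubst: "lren r (lsubst s t) = lsubst (\<lambda>i. lren r (s i)) t"
proof (induction t arbitrary: s r)
  case (Lam t)
  have "(\<lambda>i. lren (case_nat 0 (\<lambda>i. Suc (r i))) (case_nat (Var 0) (\<lambda>i. lren Suc (s i)) i))
      = case_nat (Var 0) (\<lambda>i. lren Suc (lren r (s i)))"
    by (auto simp: lren_lren split: nat.split)
  then show ?case by (simp add: Lam)
qed auto

lemma lsubst_lsubst: "lsubst s (lsubst q t) = lsubst (\<lambda>i. lsubst s (q i)) t"
proof (induction t arbitrary: s q)
  case (Lam t)
  have "(\<lambda>i. lsubst (case_nat (Var 0) (\<lambda>i. lren Suc (s i)))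
        (case_nat (Var 0) (\<lambda>i. lren Suc (q i)) i))
      = case_nat (Var 0) (\<lambda>i. lren Suc (lsubst s (q i)))"
    by (auto simp: lsubst_lren lren_lsubst split: nat.split)
  then show ?case by (simp add: Lam)
qed auto

lemma lsubst_Var [simp]: "lsubst Var t = t"
proof (induction t)
  case (Lam t)
  have "case_nat (Var 0) (\<lambda>i. lren Suc (Var i)) = Var"
    by (auto split: nat.split)
  then show ?case by (simp add: Lam)
qed auto

text \<open>The left side is the contractum of a substituted abstraction applied to
  \<open>u\<close>; the right side is the form in which the induction hypothesis of
  \<open>adequacy\<close> speaks of the body.\<close>

lemma lsubst_case_nat_lift:
  "lsubst (case_nat u Var) (lsubst (case_nat (Var 0) (\<lambda>i. lren Suc (s i))) t) = lsubst (case_nat u s) t"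
proof -
  have "(\<lambda>i. lsubst (case_nat u Var) (case_nat (Var 0) (\<lambda>i. lren Suc (s i)) i)) = case_nat u s"
    by (auto simp: lsubst_lren split: nat.split)
  then show ?thesis by (simp add: lsubst_lsubst)
qed

lemma apps_Nil [simp]: "apps t [] = t"
  and apps_Cons [simp]: "apps t (u # us) = apps (App t u) us"
  and apps_snoc: "apps t (us @ [u]) = App (apps t us) u"
  by (simp_all add: apps_def)

lemma lsubst_apps: "lsubst s (apps t us) = apps (lsubst s t) (map (lsubst s) us)"
  by (induction us arbitrary: t) auto


section \<open>The realizability interpretation\<close>

text \<open>Only beta steps are considered: they survive when arguments are appended, as implication
  requires, whereas a \<open>ctrl\<close> step captures all the arguments present.\<close>

definition beta_closed :: "lam set \<Rightarrow> bool" where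
  "beta_closed X \<longleftrightarrow> (\<forall>u t ts. apps (lsubst (case_nat t Var) u) ts \<in> X \<longrightarrow> apps (App (Lam u) t) ts \<in> X)"

definition push :: "kind \<Rightarrow> nat \<Rightarrow> 'a \<Rightarrow> (kind \<Rightarrow> nat \<Rightarrow> nat \<Rightarrow> 'a) \<Rightarrow> kind \<Rightarrow> nat \<Rightarrow> nat \<Rightarrow> 'a" where
  "push k n Z e = (\<lambda>k' n'. if k' = k \<and> n' = n then case_nat Z (e k n) else e k' n')"

lemma push_0: "push k n Z e k n 0 = Z"
  by (simp add: push_def)

locale pole =
  fixes P :: "lam set"
  assumes expansion: "stepC a b \<Longrightarrow> b \<in> P \<Longrightarrow> a \<in> P"
begin

text \<open>Krivine's orthogonal: argument lists serve as stacks, and a term applied to its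
  arguments as a process.\<close>

definition orth :: "lam list set \<Rightarrow> lam set" where
  "orth S = {t. \<forall>\<pi>\<in>S. apps t \<pi> \<in> P}"

definition truth :: "kind \<Rightarrow> lam set set" where
  "truth k = (case k of Ordinary \<Rightarrow> {X. beta_closed X} | Classical \<Rightarrow> range orth)"

definition valuation :: "(kind \<Rightarrow> nat \<Rightarrow> nat \<Rightarrow> lam set) \<Rightarrow> bool" where
  "valuation e \<longleftrightarrow> (\<forall>k n i. e k n i \<in> truth k)"

text \<open>First-order terms enter only through the length of argument lists. For predicate symbols
  \<open>UNIV\<close> is merely a convenient beta-closed value.\<close>

primrec interp :: "(kind \<Rightarrow> nat \<Rightarrow> nat \<Rightarrow> lam set) \<Rightarrow> ('f, 'p) form \<Rightarrow> lam set" where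
  "interp e Bot = P"
| "interp e (PSym p us) = UNIV"
| "interp e (PVar k i us) = e k (length us) i"
| "interp e (Imp A B) = {t. \<forall>u \<in> interp e A. App t u \<in> interp e B}"
| "interp e (All1 A) = interp e A"
| "interp e (All2 k n A) = (\<Inter>Z \<in> truth k. interp (push k n Z e) A)"

section \<open>Interpretation of substituted types\<close>

lemma interp_fsubst [simp]: "interp e (fsubst s A) = interp e A"
  by (induction A arbitrary: e s) auto

lemma interp_pren: "interp e (pren r A) = interp (\<lambda>k n i. e k n (r k n i)) A"
proof (induction A arbitrary: e r)
  case (All2 k n A)
  have "(\<lambda>k' n' i. push k n Z e k' n'
        ((if k' = k \<and> n' = n then case_nat 0 (\<lambda>i. Suc (r k n i)) else r k' n') i))
      = push k n Z (\<lambda>k n i. e k n (r k n i))" for Z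
    by (intro ext) (auto simp: push_def split: nat.split)
  then show ?case by (simp add: All2)
qed auto

lemma interp_pshift: "interp (push k n Z e) (pshift k n A) = interp e A"
proof -
  have "(\<lambda>k' n' i. push k n Z e k' n' (if k' = k \<and> n' = n then Suc i else i)) = e"
    by (intro ext) (auto simp: push_def)
  then show ?thesis by (simp add: pshift_def interp_pren)
qed

text \<open>In the variable case \<open>interp_fsubst\<close> erases the substitution for the
  parameters; under a second-order quantifier, shifting and pushing cancel.\<close>

lemma interp_psubst: "interp e (psubst s A) = interp (\<lambda>k n i. interp e (s k n i)) A"
proof (induction A arbitrary: e s)
  case (All2 k n A)
  have "(\<lambda>k' n' i. interp (push k n Z e)
        ((if k' = k \<and> n' = n then case_nat (pvar k n 0) (\<lambda>i. pshift k n (s k n i))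
          else (\<lambda>i. pshift k n (s k' n' i))) i))
      = push k n Z (\<lambda>k n i. interp e (s k n i))" for Z
    \<comment> \<open>Only the right-hand \<open>push\<close> is unfolded; the left one stays folded
      so that \<open>interp_pshift\<close> and \<open>push_0\<close> match.\<close>
    by (intro ext) (auto simp: interp_pshift pvar_def push_def[of k n Z "\<lambda>k n i. interp e (s k n i)"]
        push_0 split: nat.split)
  then show ?case by (simp add: All2)
qed auto

lemma interp_pinst: "interp e (pinst k n G A) = interp (push k n (interp e G) e) A"
proof -
  have "(\<lambda>k' n' i. interp e ((if k' = k \<and> n' = n then case_nat G (\<lambda>i. pvar k n i) else pvar k' n') i))
      = push k n (interp e G) e"
    by (intro ext) (auto simp: push_def pvar_def split: nat.split)
  then show ?thesis by (simp add: pinst_def interp_psubst)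
qed

section \<open>Closure under head beta-expansion\<close>

lemma beta_closed_orth: "beta_closed (orth S)"
proof -
  have "apps (apps (App (Lam u) t) ts) \<pi> \<in> P"
    if "apps (apps (lsubst (case_nat t Var) u) ts) \<pi> \<in> P" for u t ts \<pi>
    \<comment> \<open>Appending the stack to the arguments of a beta redex gives a redex of the same
      shape.\<close>
    using expansion[OF stepC.beta[of u t "ts @ \<pi>"]] that by (simp add: apps_def)
  then show ?thesis by (auto simp: beta_closed_def orth_def)
qed

text \<open>The empty stack makes the value of \<open>Bot\<close> an orthogonal.\<close>

lemma orth_Nil: "orth {[]} = P"
  by (simp add: orth_def)

lemma beta_closed_truth: "X \<in> truth k \<Longrightarrow> beta_closed X"
  using beta_closed_orth by (auto simp: truth_def split: kind.splits)

lemma valuation_push: "valuation e \<Longrightarrow> Z \<in> truth k \<Longrightarrow> valuation (push k n Z e)"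
  by (auto simp: valuation_def push_def split: nat.split)

lemma beta_closed_interp: "valuation e \<Longrightarrow> beta_closed (interp e A)"
proof (induction A arbitrary: e)
  case Bot
  then show ?case using beta_closed_orth[of "{[]}"] by (simp add: orth_Nil)
next
  case (PVar k i us)
  then show ?case using beta_closed_truth[of _ k] by (simp add: valuation_def)
next
  case (Imp A B)
  have "beta_closed (interp e B)" using Imp by blast
  \<comment> \<open>The argument supplied to an implication becomes the last entry of the argument
    list.\<close>
  then have "apps (App (Lam u) t) (ts @ [v]) \<in> interp e B"
    if "apps (lsubst (case_nat t Var) u) (ts @ [v]) \<in> interp e B" for u t ts v
    using that by (simp only: beta_closed_def)
  then show ?case by (simp add: beta_closed_def apps_snoc)
next
  case (All2 k n A)
  then have "beta_closed (interp (push k n Z e) A)" if "Z \<in> truth k" for Z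
    using that valuation_push by blast
  then show ?case unfolding beta_closed_def interp.simps by blast
qed (auto simp: beta_closed_def)

section \<open>Classical types, the constant and adequacy\<close>

lemma classical_type_simps [simp]:
  "classical_type Bot" "\<not> classical_type (PSym p us)"
  "classical_type (PVar k i us) \<longleftrightarrow> k = Classical"
  "classical_type (Imp A B) \<longleftrightarrow> classical_type B"
  "classical_type (All1 A) \<longleftrightarrow> classical_type A"
  "classical_type (All2 k n A) \<longleftrightarrow> classical_type A"
  by (auto simp: classical_type_def)

text \<open>Implication prefixes realizers of its premise to the stacks, and an intersection of
  orthogonals is the orthogonal of the union; hence only the ending of a type matters.\<close>

lemma interp_classical: "classical_type A \<Longrightarrow> valuation e \<Longrightarrow> interp e A \<in> range orth"
proof (induction A arbitrary: e)
  case Bot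
  then show ?case using orth_Nil by auto
next
  case (PVar k i us)
  then have "e Classical (length us) i \<in> truth Classical" and "k = Classical"
    by (simp_all add: valuation_def)
  then show ?case by (simp add: truth_def)
next
  case (Imp A B)
  then have "interp e B \<in> range orth" by simp
  then obtain S where S: "interp e B = orth S" by blast
  have "interp e (Imp A B) = orth (\<Union>u \<in> interp e A. (#) u ` S)"
    by (simp add: S orth_def)
  then show ?case by blast
next
  case (All2 k n A)
  then have "\<forall>Z \<in> truth k. interp (push k n Z e) A \<in> range orth"
    by (simp add: valuation_push)
  then have "\<forall>Z \<in> truth k. \<exists>S. interp (push k n Z e) A = orth S"
    by blast
  then obtain S where "\<forall>Z \<in> truth k. interp (push k n Z e) A = orth (S Z)" by metis
  then have "interp e (All2 k n A) = orth (\<Union>Z \<in> truth k. S Z)"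
    by (auto simp: orth_def)
  then show ?case by blast
qed auto

text \<open>The second assumption says that \<open>t\<close> realizes the double negation of
  \<open>X\<close>. The \<open>ctrl\<close> step hands \<open>t\<close> the captured stack as a
  continuation, which realizes the negation of \<open>X\<close>.\<close>

lemma Cst_realizes:
  assumes "X \<in> range orth" and "\<And>v. (\<And>w. w \<in> X \<Longrightarrow> App v w \<in> P) \<Longrightarrow> App t v \<in> P"
  shows "App Cst t \<in> X"
proof -
  obtain S where S: "X = orth S" using assms(1) by auto
  have "apps (App Cst t) \<pi> \<in> P" if "\<pi> \<in> S" for \<pi>
  proof -
    let ?v = "Lam (apps (Var 0) (map (lren Suc) \<pi>))"
    have "App ?v w \<in> P" if "w \<in> X" for w
    proof (rule expansion)
      \<comment> \<open>Substituting for the bound variable undoes the renaming by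
        \<open>Suc\<close> and puts \<open>w\<close> in front of the stack.\<close>
      show "stepC (App ?v w) (apps w \<pi>)"
        using stepC.beta[of "apps (Var 0) (map (lren Suc) \<pi>)" w "[]"]
        by (simp add: lsubst_apps lsubst_lren comp_def)
      show "apps w \<pi> \<in> P" using \<open>w \<in> X\<close> \<open>\<pi> \<in> S\<close> by (simp add: S orth_def)
    qed
    then have "App t ?v \<in> P" by (rule assms(2))
    with stepC.ctrl show ?thesis by (rule expansion)
  qed
  then show ?thesis by (simp add: S orth_def)
qed

lemma adequacy:
  assumes "M2 L E \<Gamma> t A" and "valuation e" and "\<forall>i < length \<Gamma>. s i \<in> interp e (\<Gamma> ! i)"
  shows "lsubst s t \<in> interp e A"
  using assms
proof (induction arbitrary: e s rule: M2.induct)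
  case (ax \<Gamma> i)
  then show ?case by simp
next
  case (impI A \<Gamma> t B)
  have "App (lsubst s (Lam t)) u \<in> interp e B" if u: "u \<in> interp e A" for u
  proof -
    have "\<forall>i < length (A # \<Gamma>). case_nat u s i \<in> interp e ((A # \<Gamma>) ! i)"
      using impI.prems(2) u by (auto split: nat.split)
    \<comment> \<open>The empty argument list gives the shape that \<open>beta_closed\<close>
      expects.\<close>
    then have "apps (lsubst (case_nat u Var) (lsubst (case_nat (Var 0) (\<lambda>i. lren Suc (s i))) t)) []
        \<in> interp e B"
      using impI.IH[OF impI.prems(1)] by (simp add: lsubst_case_nat_lift)
    then show ?thesis
      using beta_closed_interp[OF impI.prems(1)] unfolding beta_closed_def by fastforce
  qed
  then show ?case by simp
next
  case (impE \<Gamma> t A B u)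
  then show ?case by fastforce
next
  case (all1I \<Gamma> t A)
  then show ?case by (simp add: fshift_def)
next
  case (all1E \<Gamma> t A u)
  then show ?case by (simp add: finst_def)
next
  \<comment> \<open>The shifted context keeps its value under any pushed \<open>Z\<close>, so the
    same realizers \<open>s\<close> serve for every \<open>Z\<close>.\<close>
  case (all2I n \<Gamma> t A)
  then show ?case by (simp add: interp_pshift valuation_push)
next
  case (all2E \<Gamma> t n A G)
  moreover from all2E have "interp e G \<in> truth Ordinary"
    by (simp add: truth_def beta_closed_interp)
  ultimately show ?case by (simp add: interp_pinst)
next
  case (eqn \<Gamma> t u A v)
  then show ?case by (simp add: finst_def)
next
  case (cst \<Gamma>)
  show ?case by (auto intro: Cst_realizes simp: truth_def push_def)
next
  case (allCI n \<Gamma> t A)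
  then show ?case by (simp add: interp_pshift valuation_push)
next
  case (allCE \<Gamma> t n A G)
  moreover from allCE have "interp e G \<in> truth Classical"
    by (simp add: truth_def interp_classical)
  ultimately show ?case by (simp add: interp_pinst)
qed

text \<open>\<open>P\<close> is both beta-closed and an orthogonal, so it can interpret variables of
  both kinds.\<close>

lemma valuation_const: "valuation (\<lambda>k n i. P)"
  using beta_closed_orth[of "{[]}"]
  by (auto simp: valuation_def truth_def orth_Nil split: kind.split intro: range_eqI[of _ _ "{[]}"])

end

theorem theorem7p1:
  fixes L :: "('f, 'p) lang"
    and E :: "('f tm \<times> 'f tm) set"
    and T t :: lam
    and n :: "nat"
    and ts :: "lam list"
  assumes "\<forall>(a, b) \<in> E. wf_tm L a \<and> wf_tm L b"
    and "M2 L E [] T (All2 Classical 0 (Imp Bot (PVar Classical 0 [])))"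
    and "length ts = n"
  shows "apps (App T t) ts \<succ>\<^sub>C t"
proof -
  interpret pole "{u. u \<succ>\<^sub>C t}"
    by unfold_locales (auto simp: redC_def intro: converse_rtranclp_into_rtranclp)
  have "T \<in> interp (\<lambda>k n i. {u. u \<succ>\<^sub>C t})
      (All2 Classical 0 (Imp Bot (PVar Classical 0 [])) :: ('f, 'p) form)"
    \<comment> \<open>The context is empty, so \<open>Var\<close> serves as the substitution and
      leaves \<open>T\<close> unchanged.\<close>
    using adequacy[OF assms(2) valuation_const, of Var] by simp
  moreover have "orth {ts} \<in> truth Classical"
    by (simp add: truth_def)
  ultimately have "T \<in> interp (push Classical 0 (orth {ts}) (\<lambda>k n i. {u. u \<succ>\<^sub>C t}))
      (Imp Bot (PVar Classical 0 []) :: ('f, 'p) form)"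
    by simp
  \<comment> \<open>By reflexivity \<open>t\<close> realizes \<open>Bot\<close>.\<close>
  moreover have "t \<succ>\<^sub>C t" by (simp add: redC_def)
  ultimately have "App T t \<in> orth {ts}" by (simp add: push_def)
  then show ?thesis by (simp add: orth_def)
qed

end
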